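(* For every positive integer $m$, $$\mathrm{forb}(m,F(0,7,1,0))\le \Big\lfloor \tfrac{24}{5}m\Big\rfloor+1,$$ with equality when $m\equiv 0\pmod 5$.
   Context: A matrix is simple if it is a $(0,1)$-matrix with no repeated columns. For $(0,1)$-matrices $F,A$, $F$ is a configuration in $A$ (written $F\prec A$) if some submatrix of $A$ is a row and column permutation of $F$. $\mathrm{Avoid}(m,F)$ is the set of all simple $m$-rowed matrices $A$ with $F\not\prec A$, and $\mathrm{forb}(m,F)$ is the maximum number of columns of a matrix in $\mathrm{Avoid}(m,F)$. For $p\ge 1$, $F(0,p,1,0)$ is the $2\times(p+1)$ matrix whose first $p$ columns are $\binom{1}{0}$ and whose last column is $\binom{0}{1}$. *)

theory Defs
  imports
    Complex_Main
    "HOL-Number_Theory.Cong"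
    "HOL-Combinatorics.Permutations"
    "Jordan_Normal_Form.DL_Submatrix"
begin

definition simple_mat :: "int mat \<Rightarrow> bool" where
  "simple_mat A \<longleftrightarrow> elements_mat A \<subseteq> {0, 1} \<and> distinct (cols A)"

definition row_col_permutation :: "'a mat \<Rightarrow> 'a mat \<Rightarrow> bool" where
  "row_col_permutation B F \<longleftrightarrow>
     (\<exists>p q. p permutes {..<dim_row F} \<and> q permutes {..<dim_col F} \<and>
        B = mat (dim_row F) (dim_col F) (\<lambda>(i, j). F $$ (p i, q j)))"

definition configuration :: "'a mat \<Rightarrow> 'a mat \<Rightarrow> bool"  (infix "\<prec>" 50) where
  "F \<prec> A \<longleftrightarrow> (\<exists>I J. row_col_permutation (submatrix A I J) F)"

definition Avoid :: "nat \<Rightarrow> int mat \<Rightarrow> int mat set" where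
  "Avoid m F = {A. simple_mat A \<and> dim_row A = m \<and> \<not> F \<prec> A}"

definition forb :: "nat \<Rightarrow> int mat \<Rightarrow> nat" where
  "forb m F = Max (dim_col ` Avoid m F)"

definition F_0p10 :: "nat \<Rightarrow> int mat" where
  "F_0p10 p = mat 2 (p + 1)
     (\<lambda>(i, j). if j < p then (if i = 0 then 1 else 0) else (if i = 0 then 0 else 1))"

text \<open>
  The maximum in \<^const>\<open>forb\<close> is attained: the column counts are bounded by
  \<open>2 ^ m\<close>, and the matrix without columns avoids every \<open>F\<close> that has a column.
\<close>

lemma simple_mat_dim_col_le:
  assumes "simple_mat A"
  shows "dim_col A \<le> 2 ^ dim_row A"
proof -
  let ?L = "{xs :: int list. set xs \<subseteq> {0, 1} \<and> length xs = dim_row A}"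
  have inj: "inj_on list_of_vec (set (cols A))"
    by (metis inj_onI vec_list)
  have "list_of_vec c \<in> ?L" if c: "c \<in> set (cols A)" for c
  proof -
    from c obtain j where j: "j < dim_col A" "c = col A j"
      by (auto simp: cols_def)
    have "\<forall>i < dim_row A. col A j $ i \<in> {0, 1}"
      using j assms unfolding simple_mat_def elements_mat_def by fastforce
    then show ?thesis
      using j by (auto simp: set_conv_nth list_of_vec_index)
  qed
  then have sub: "list_of_vec ` set (cols A) \<subseteq> ?L" by blast
  have "finite ?L" by (rule finite_lists_length_eq) simp
  then have "card (list_of_vec ` set (cols A)) \<le> card ?L"
    using sub by (rule card_mono)
  also have "card ?L = 2 ^ dim_row A"
    by (subst card_lists_length_eq) (auto simp: numeral_2_eq_2)
  finally have "card (set (cols A)) \<le> 2 ^ dim_row A"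
    using inj by (simp add: card_image)
  moreover have "card (set (cols A)) = dim_col A"
    using assms by (simp add: simple_mat_def distinct_card)
  ultimately show ?thesis by simp
qed

lemma finite_dim_col_Avoid: "finite (dim_col ` Avoid m F)"
  by (rule finite_subset[of _ "{..2 ^ m}"])
    (auto simp: Avoid_def dest: simple_mat_dim_col_le)

lemma Avoid_nonempty:
  assumes "dim_col F > 0"
  shows "Avoid m F \<noteq> {}"
proof -
  have "dim_col (submatrix (mat m 0 f) I J) = 0" for f :: "nat \<times> nat \<Rightarrow> int" and I J
    by (simp add: dim_submatrix)
  then have "\<not> F \<prec> mat m 0 f" for f
    using assms unfolding configuration_def row_col_permutation_def
    by (metis dim_col_mat(1) less_numeral_extra(3))
  moreover have "simple_mat (mat m 0 f)" for f
    by (auto simp: simple_mat_def elements_mat_def cols_def)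
  ultimately show ?thesis by (fastforce simp: Avoid_def)
qed

lemma forb_attained:
  assumes "dim_col F > 0"
  shows "\<exists>A \<in> Avoid m F. dim_col A = forb m F"
    and "\<And>A. A \<in> Avoid m F \<Longrightarrow> dim_col A \<le> forb m F"
proof -
  have "forb m F \<in> dim_col ` Avoid m F"
    unfolding forb_def using finite_dim_col_Avoid Avoid_nonempty[OF assms] by (intro Max_in) auto
  then show "\<exists>A \<in> Avoid m F. dim_col A = forb m F" by auto
  show "\<And>A. A \<in> Avoid m F \<Longrightarrow> dim_col A \<le> forb m F"
    unfolding forb_def using finite_dim_col_Avoid by (intro Max_ge) auto
qed

end

theory Submission
  imports Defs
begin

text \<open>
  Read the columns as a family \<open>F\<close> of subsets of the row set. Avoiding the configuration means that,
  for any two rows \<open>i\<close>, \<open>j\<close>, either at most \<open>6\<close> sets contain \<open>i\<close> but not \<open>j\<close>, or no set contains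
  \<open>j\<close> but not \<open>i\<close>; rows are \<^emph>\<open>incomparable\<close> if sets of both kinds exist, and then there are at most
  \<open>6\<close> of each kind.

  The upper bound is by induction on the number of rows: some nonempty set \<open>S\<close> of rows can be deleted
  so that at most \<open>24/5 * |S|\<close> columns are lost. Suppose not. The loss on deleting \<open>S\<close> is at most
  the number of sets that split \<open>S\<close> (mixed sets) plus the number of \<open>B\<close> disjoint from \<open>S\<close> with both
  \<open>B\<close> and \<open>B \<union> S\<close> in \<open>F\<close> (toggles), and there is at most one toggle if every row outside \<open>S\<close> is
  comparable to a row of \<open>S\<close>. If incomparability were not transitive, there would be comparable
  rows \<open>x\<close>, \<open>y\<close> with a common incomparable row; take \<open>S\<close> to be \<open>x\<close>, \<open>y\<close> and a maximal antichain \<open>Z\<close>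
  of such rows. Double counting the incomparable pairs split by the mixed sets of \<open>S\<close>, where the at
  least three toggles of \<open>{x, y, z}\<close> for each \<open>z \<in> Z\<close> produce sets splitting more pairs than
  necessary, gives \<open>|Z| = 3\<close>, and the five toggles of each of \<open>{x}\<close> and \<open>{y}\<close> rule out this last case.
  So incomparability is transitive, and the mixed sets of one of its classes have distinct traces on
  it; counting split pairs again shows that there are too few of them.

  For \<open>m = 5 * k\<close>, stack \<open>k\<close> copies of a family of \<open>25\<close> subsets of a \<open>5\<close>-set, the full set of each
  copy being identified with the empty set of the next one.
\<close>

section \<open>Families of sets with few separations\<close>

definition only :: "'a set set \<Rightarrow> 'a \<Rightarrow> 'a \<Rightarrow> 'a set set" where
  "only F i j = {A \<in> F. i \<in> A \<and> j \<notin> A}"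

definition incomparable :: "'a set set \<Rightarrow> 'a \<Rightarrow> 'a \<Rightarrow> bool" where
  "incomparable F i j \<longleftrightarrow> only F i j \<noteq> {} \<and> only F j i \<noteq> {}"

definition mixed :: "'a set set \<Rightarrow> 'a set \<Rightarrow> 'a set set" where
  "mixed F S = {A \<in> F. A \<inter> S \<noteq> {} \<and> \<not> S \<subseteq> A}"

definition toggles :: "'a set set \<Rightarrow> 'a set \<Rightarrow> 'a set set" where
  "toggles F S = {B \<in> F. B \<inter> S = {} \<and> B \<union> S \<in> F}"

lemma incomparable_sym: "incomparable F i j \<Longrightarrow> incomparable F j i"
  by (auto simp: incomparable_def)

lemma not_incomparable_self: "\<not> incomparable F i i"
  by (auto simp: incomparable_def only_def)

text \<open>Among sets that are not mixed, deletion can only merge some \<open>B\<close> disjoint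
  from \<open>S\<close> with \<open>B \<union> S\<close>, and such a \<open>B\<close> is a
  toggle.\<close>

lemma card_le_card_deletion:
  assumes "finite F" "S \<noteq> {}"
  shows "card F \<le> card ((\<lambda>A. A - S) ` F) + card (mixed F S) + card (toggles F S)"
proof -
  let ?C0 = "{A \<in> F. A \<inter> S = {}}" and ?C1 = "{A \<in> F. S \<subseteq> A}"
  let ?D1 = "(\<lambda>A. A - S) ` ?C1"
  have "F = mixed F S \<union> (?C0 \<union> ?C1)" by (auto simp: mixed_def)
  then have "card F \<le> card (mixed F S) + card (?C0 \<union> ?C1)"
    by (metis card_Un_le)
  also have "card (?C0 \<union> ?C1) \<le> card ?C0 + card ?C1" by (rule card_Un_le)
  finally have 1: "card F \<le> card (mixed F S) + (card ?C0 + card ?C1)" by simp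
  have "inj_on (\<lambda>A. A - S) ?C1" by (rule inj_onI) blast
  then have 2: "card ?D1 = card ?C1" by (rule card_image)
  have 3: "card ?C0 + card ?D1 = card (?C0 \<union> ?D1) + card (?C0 \<inter> ?D1)"
    using assms by (intro card_Un_Int) auto
  have "?C0 \<union> ?D1 \<subseteq> (\<lambda>A. A - S) ` F" by (auto simp: image_iff Diff_triv intro!: bexI)
  then have 4: "card (?C0 \<union> ?D1) \<le> card ((\<lambda>A. A - S) ` F)"
    using assms by (intro card_mono) auto
  have "?C0 \<inter> ?D1 \<subseteq> toggles F S"
    by (auto simp: toggles_def Un_absorb2 Diff_partition Un_commute)
  then have 5: "card (?C0 \<inter> ?D1) \<le> card (toggles F S)"
    using assms by (intro card_mono) (auto simp: toggles_def)
  show ?thesis using 1 2 3 4 5 by linarith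
qed

text \<open>A toggle \<open>B\<close> containing \<open>w\<close> separates \<open>w\<close> from a
  comparable \<open>q \<in> S\<close>, so every set with \<open>q\<close> contains \<open>w\<close>.
  Applied to \<open>B' \<union> S\<close>, this gives \<open>B \<subseteq> B'\<close> for any two
  toggles.\<close>

lemma card_toggles_le_1:
  assumes "\<And>B w. B \<in> F \<Longrightarrow> w \<in> B \<Longrightarrow> w \<in> P"
    and cmp: "\<And>w. w \<in> P - S \<Longrightarrow> \<exists>q\<in>S. \<not> incomparable F w q"
  shows "card (toggles F S) \<le> 1"
proof -
  have "w \<in> B'" if B: "B \<in> toggles F S" "B' \<in> toggles F S" "w \<in> B" for B B' w
  proof -
    have "w \<in> P - S" using B assms(1) by (auto simp: toggles_def)
    then obtain q where q: "q \<in> S" "\<not> incomparable F w q" using cmp by blast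
    have "B \<in> only F w q" using B q by (auto simp: toggles_def only_def)
    then have "only F q w = {}" using q by (auto simp: incomparable_def)
    moreover have "B' \<union> S \<in> F" using B by (auto simp: toggles_def)
    ultimately have "w \<in> B' \<union> S" using q by (auto simp: only_def)
    then show ?thesis using \<open>w \<in> P - S\<close> by blast
  qed
  then have "B = B'" if "B \<in> toggles F S" "B' \<in> toggles F S" for B B' using that by blast
  then show ?thesis by (cases "finite (toggles F S)") (auto simp: card_le_Suc0_iff_eq)
qed

lemma sum_card_swap:
  assumes "finite F" "finite Z"
  shows "(\<Sum>z\<in>Z. card {A \<in> F. R z A}) = (\<Sum>A\<in>F. card {z \<in> Z. R z A})"
proof -
  have "(\<Sum>z\<in>Z. card {A \<in> F. R z A}) = (\<Sum>z\<in>Z. \<Sum>A\<in>{A \<in> F. R z A}. 1)" by simp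
  also have "\<dots> = (\<Sum>A\<in>F. \<Sum>z\<in>{z \<in> Z. R z A}. 1)"
    using assms(2,1) by (rule sum.swap_restrict)
  finally show ?thesis by simp
qed

section \<open>Thin families, and those in which every deletion loses too much\<close>

locale thin_family =
  fixes P :: "'a set" and F :: "'a set set"
  assumes finite_P: "finite P" and F_Pow: "F \<subseteq> Pow P"
    and thin: "\<And>i j. i \<in> P \<Longrightarrow> j \<in> P \<Longrightarrow> card (only F i j) \<le> 6 \<or> only F j i = {}"
begin

lemma finite_F: "finite F"
  using finite_P F_Pow by (meson finite_Pow_iff finite_subset)

lemma only_le_6:
  assumes "incomparable F i j"
  shows "card (only F i j) \<le> 6"
proof -
  have "i \<in> P" "j \<in> P" using assms F_Pow by (auto simp: incomparable_def only_def)
  then show ?thesis using thin assms by (auto simp: incomparable_def)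
qed

lemma thin_family_deletion: "thin_family (P - S) ((\<lambda>A. A - S) ` F)"
proof
  fix i j assume ij: "i \<in> P - S" "j \<in> P - S"
  have img: "only ((\<lambda>A. A - S) ` F) k l = (\<lambda>A. A - S) ` only F k l"
    if "k \<in> P - S" "l \<in> P - S" for k l
    using that by (auto simp: only_def)
  have "card ((\<lambda>A. A - S) ` only F i j) \<le> card (only F i j)"
    using finite_F by (intro card_image_le) (auto simp: only_def)
  then show "card (only ((\<lambda>A. A - S) ` F) i j) \<le> 6 \<or> only ((\<lambda>A. A - S) ` F) j i = {}"
    using thin[of i j] ij by (auto simp: img)
qed (use finite_P F_Pow in auto)

text \<open>Double counting: the summand is the number of ordered pairs in \<open>Z\<close>
  separated by \<open>A\<close>, and each ordered pair of distinct rows is separated by at most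
  \<open>6\<close> sets.\<close>

lemma sum_only_pairs:
  assumes "finite Z" and "\<And>z z'. z \<in> Z \<Longrightarrow> z' \<in> Z \<Longrightarrow> z \<noteq> z' \<Longrightarrow> incomparable F z z'"
  shows "(\<Sum>A\<in>F. card (A \<inter> Z) * (card Z - card (A \<inter> Z))) \<le> 6 * card Z * (card Z - 1)"
proof -
  let ?ZZ = "Z \<times> Z - Id"
  have "{p \<in> ?ZZ. fst p \<in> A \<and> snd p \<notin> A} = (A \<inter> Z) \<times> (Z - A)" for A by auto
  then have c: "card {p \<in> ?ZZ. fst p \<in> A \<and> snd p \<notin> A} = card (A \<inter> Z) * (card Z - card (A \<inter> Z))"
    for A using assms(1) by (simp add: card_cartesian_product card_Diff_subset_Int Int_commute)
  have "?ZZ = Z \<times> Z - (\<lambda>z. (z, z)) ` Z" by auto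
  moreover have "card ((\<lambda>z. (z, z)) ` Z) = card Z" by (rule card_image) (auto simp: inj_on_def)
  ultimately have n: "card ?ZZ = card Z * (card Z - 1)"
    using assms(1) by (simp add: card_Diff_subset image_subset_iff card_cartesian_product diff_mult_distrib2)
  have "(\<Sum>p\<in>?ZZ. card {A \<in> F. fst p \<in> A \<and> snd p \<notin> A}) \<le> (\<Sum>p\<in>?ZZ. 6)"
  proof (rule sum_mono)
    fix p assume "p \<in> ?ZZ"
    then have "fst p \<in> Z" "snd p \<in> Z" "fst p \<noteq> snd p" by auto
    then have "incomparable F (fst p) (snd p)" by (rule assms(2))
    then show "card {A \<in> F. fst p \<in> A \<and> snd p \<notin> A} \<le> 6" using only_le_6 by (simp add: only_def)
  qed
  also have "(\<Sum>p\<in>?ZZ. card {A \<in> F. fst p \<in> A \<and> snd p \<notin> A})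
      = (\<Sum>A\<in>F. card {p \<in> ?ZZ. fst p \<in> A \<and> snd p \<notin> A})"
    using assms(1) finite_F by (intro sum_card_swap) auto
  finally show ?thesis unfolding c by (simp add: n)
qed

end

text \<open>The situation to be refuted: deleting any nonempty \<open>S\<close> costs more than
  \<open>24/5 * |S|\<close> sets. Multiplying by \<open>5\<close> keeps the inequality in the
  natural numbers.\<close>

locale irreducible_family = thin_family +
  assumes nonempty: "P \<noteq> {}"
    and irreducible: "\<And>S. S \<subseteq> P \<Longrightarrow> S \<noteq> {} \<Longrightarrow>
      24 * card S + 5 * card ((\<lambda>A. A - S) ` F) < 5 * card F"
begin

lemma mixed_toggles:
  assumes "S \<subseteq> P" "S \<noteq> {}"
  shows "24 * card S < 5 * card (mixed F S) + 5 * card (toggles F S)"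
  using irreducible[OF assms] card_le_card_deletion[OF finite_F assms(2)] by linarith

text \<open>A single row has no mixed sets, so toggles alone account for a loss above
  \<open>24/5\<close>.\<close>

lemma five_toggles:
  assumes "x \<in> P"
  shows "5 \<le> card (toggles F {x})"
proof -
  have "mixed F {x} = {}" by (auto simp: mixed_def)
  then show ?thesis using mixed_toggles[of "{x}"] assms by simp
qed

lemma spanning_mixed:
  assumes "S \<subseteq> P" "S \<noteq> {}" and "\<And>w. w \<in> P - S \<Longrightarrow> \<exists>q\<in>S. \<not> incomparable F w q"
  shows "24 * card S < 5 * card (mixed F S) + 5"
proof -
  have "card (toggles F S) \<le> 1" using assms F_Pow by (intro card_toggles_le_1[of F P]) auto
  then show ?thesis using mixed_toggles[OF assms(1,2)] by linarith
qed

end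

section \<open>Two comparable rows with common incomparable rows\<close>

context thin_family
begin

lemma sum_only_left:
  assumes "finite Z" and "\<And>z. z \<in> Z \<Longrightarrow> incomparable F x z"
  shows "(\<Sum>A\<in>F. if x \<in> A then card Z - card (A \<inter> Z) else 0) \<le> 6 * card Z"
proof -
  have "card {z \<in> Z. x \<in> A \<and> z \<notin> A} = (if x \<in> A then card Z - card (A \<inter> Z) else 0)" for A
  proof -
    have "{z \<in> Z. z \<notin> A} = Z - A" by auto
    then show ?thesis using assms(1) by (simp add: card_Diff_subset_Int Int_commute)
  qed
  then have "(\<Sum>A\<in>F. if x \<in> A then card Z - card (A \<inter> Z) else 0)
      = (\<Sum>z\<in>Z. card {A \<in> F. x \<in> A \<and> z \<notin> A})"
    using sum_card_swap[OF finite_F assms(1), of "\<lambda>z A. x \<in> A \<and> z \<notin> A"] by simp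
  also have "\<dots> \<le> (\<Sum>z\<in>Z. 6)"
    using only_le_6 assms(2) by (intro sum_mono) (simp add: only_def)
  finally show ?thesis by simp
qed

lemma sum_only_right:
  assumes "finite Z" and "\<And>z. z \<in> Z \<Longrightarrow> incomparable F z y"
  shows "(\<Sum>A\<in>F. if y \<notin> A then card (A \<inter> Z) else 0) \<le> 6 * card Z"
proof -
  have "card {z \<in> Z. z \<in> A \<and> y \<notin> A} = (if y \<notin> A then card (A \<inter> Z) else 0)" for A
    by (simp add: Int_def conj_commute)
  then have "(\<Sum>A\<in>F. if y \<notin> A then card (A \<inter> Z) else 0)
      = (\<Sum>z\<in>Z. card {A \<in> F. z \<in> A \<and> y \<notin> A})"
    using sum_card_swap[OF finite_F assms(1), of "\<lambda>z A. z \<in> A \<and> y \<notin> A"] by simp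
  also have "\<dots> \<le> (\<Sum>z\<in>Z. 6)"
    using only_le_6 assms(2) by (intro sum_mono) (simp add: only_def)
  finally show ?thesis by simp
qed

end

text \<open>With \<open>t = |A \<inter> Z|\<close>, both identities say that the cover is
  \<open>K\<close> plus the excess, first for sets avoiding \<open>x\<close> and \<open>y\<close>,
  then for sets containing both. The side conditions prevent truncated subtraction.\<close>

lemma cover_arith:
  fixes t K :: nat
  assumes "t \<le> K"
  shows "1 \<le> t \<Longrightarrow> K + (t - 1) * (K - t) = t + t * (K - t)"
    and "t < K \<Longrightarrow> K + t * (K - 1 - t) = K - t + t * (K - t)"
proof -
  assume "1 \<le> t"
  then obtain a where a: "t = Suc a" by (metis Suc_le_D One_nat_def)
  obtain b where b: "K = t + b" using assms le_Suc_ex by blast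
  show "K + (t - 1) * (K - t) = t + t * (K - t)" by (simp add: a b)
next
  assume "t < K"
  then obtain b where b: "K = Suc (t + b)" using less_imp_Suc_add by blast
  show "K + t * (K - 1 - t) = K - t + t * (K - t)" by (simp add: b algebra_simps)
qed

text \<open>Every set with \<open>y\<close> contains \<open>x\<close>, so \<open>x\<close> and
  \<open>y\<close> are comparable. \<open>spanning\<close> encodes the maximality of
  \<open>Z\<close> and makes \<open>spanning_mixed\<close> applicable to
  \<open>{x, y} \<union> Z\<close>.\<close>

locale wide_chain = irreducible_family +
  fixes x y :: 'a and Z :: "'a set"
  assumes x_P: "x \<in> P" and y_P: "y \<in> P" and x_neq_y: "x \<noteq> y"
    and x_below_y: "only F y x = {}"
    and Z_P: "Z \<subseteq> P" and Z_nonempty: "Z \<noteq> {}"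
    and Z_x: "\<And>z. z \<in> Z \<Longrightarrow> incomparable F z x"
    and Z_y: "\<And>z. z \<in> Z \<Longrightarrow> incomparable F z y"
    and Z_antichain: "\<And>z z'. z \<in> Z \<Longrightarrow> z' \<in> Z \<Longrightarrow> z \<noteq> z' \<Longrightarrow> incomparable F z z'"
    and spanning: "\<And>w. w \<in> P - ({x, y} \<union> Z) \<Longrightarrow> \<exists>q\<in>{x, y} \<union> Z. \<not> incomparable F w q"
begin

abbreviation "K \<equiv> card Z"
abbreviation "Q \<equiv> {x, y} \<union> Z"

text \<open>
  \<open>cover A\<close> is the number of pairs \<open>(x, z)\<close>, \<open>(z, y)\<close>, \<open>(z, z')\<close> with \<open>z, z' \<in> Z\<close> whose first
  component belongs to \<open>A\<close> and whose second one does not. A mixed set has cover at least \<open>K\<close>. Thanks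
  to truncated subtraction, \<open>excess\<close> vanishes on sets that are not mixed.
\<close>

definition chain_cover :: "'a set \<Rightarrow> nat" where
  "chain_cover A = (if x \<in> A then K - card (A \<inter> Z) else 0) + (if y \<notin> A then card (A \<inter> Z) else 0)"

definition cover :: "'a set \<Rightarrow> nat" where
  "cover A = chain_cover A + card (A \<inter> Z) * (K - card (A \<inter> Z))"

definition excess :: "'a set \<Rightarrow> nat" where
  "excess A = (if x \<notin> A then (card (A \<inter> Z) - 1) * (K - card (A \<inter> Z)) else 0)
    + (if y \<in> A then card (A \<inter> Z) * (K - 1 - card (A \<inter> Z)) else 0)"

lemma finite_Z: "finite Z"
  using finite_P Z_P finite_subset by blast

lemma x_notin_Z: "x \<notin> Z" and y_notin_Z: "y \<notin> Z"
  using Z_x[of x] Z_y[of y] not_incomparable_self[of F] by auto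

lemma K_pos: "1 \<le> K"
  using finite_Z Z_nonempty by (simp add: Suc_leI card_gt_0_iff)

lemma card_Q: "card Q = K + 2"
  using finite_Z x_notin_Z y_notin_Z x_neq_y by simp

lemma x_in: "A \<in> F \<Longrightarrow> y \<in> A \<Longrightarrow> x \<in> A"
  using x_below_y by (auto simp: only_def)

lemma card_Int_Z_le: "card (A \<inter> Z) \<le> K"
  using finite_Z by (simp add: card_mono)

lemma card_Int_Z_eq: "card (A \<inter> Z) = K \<longleftrightarrow> Z \<subseteq> A"
  using card_subset_eq[OF finite_Z, of "A \<inter> Z"] by (auto simp: Int_absorb1)

lemma card_Int_Z_0: "card (A \<inter> Z) = 0 \<longleftrightarrow> A \<inter> Z = {}"
  using finite_Z by simp

lemma mixed_Q_cases:
  assumes "A \<in> mixed F Q"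
  obtains (none) "x \<notin> A" "y \<notin> A" "1 \<le> card (A \<inter> Z)"
    | (one) "x \<in> A" "y \<notin> A"
    | (both) "x \<in> A" "y \<in> A" "card (A \<inter> Z) < K"
proof -
  have A: "A \<in> F" "A \<inter> Q \<noteq> {}" "\<not> Q \<subseteq> A" using assms by (auto simp: mixed_def)
  show thesis
  proof (cases "y \<in> A")
    case True
    then have "x \<in> A" "\<not> Z \<subseteq> A" using A x_in by auto
    then have "card (A \<inter> Z) \<noteq> K" by (simp add: card_Int_Z_eq)
    then have "card (A \<inter> Z) < K" using card_Int_Z_le[of A] by simp
    then show thesis using both True \<open>x \<in> A\<close> by blast
  next
    case False
    show thesis
    proof (cases "x \<in> A")
      case True
      then show thesis using one False by blast
    next
      assume "x \<notin> A"
      then have "A \<inter> Z \<noteq> {}" using A False by auto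
      then have "1 \<le> card (A \<inter> Z)" using card_Int_Z_0[of A] by simp
      then show thesis using none False \<open>x \<notin> A\<close> by blast
    qed
  qed
qed

text \<open>If \<open>A\<close> contains \<open>x\<close> but not \<open>y\<close>, the chain cover
  alone is \<open>K\<close> and the excess is \<open>0\<close>; the other two cases are the
  identities of \<open>cover_arith\<close>.\<close>

lemma cover_mixed:
  assumes "A \<in> mixed F Q"
  shows "K + excess A \<le> cover A"
  using assms
proof (cases rule: mixed_Q_cases)
  case none
  then show ?thesis
    using cover_arith(1)[OF card_Int_Z_le[of A]] by (simp add: cover_def chain_cover_def excess_def)
next
  case one
  then show ?thesis
    using card_Int_Z_le[of A] by (simp add: cover_def chain_cover_def excess_def)
next
  case both
  then show ?thesis
    using cover_arith(2)[OF card_Int_Z_le[of A]] by (simp add: cover_def chain_cover_def excess_def)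
qed

lemma excess_not_mixed:
  assumes "A \<in> F" "A \<notin> mixed F Q"
  shows "excess A = 0"
proof -
  have "A \<inter> Q = {} \<or> Q \<subseteq> A" using assms by (auto simp: mixed_def)
  then show ?thesis
  proof
    assume "A \<inter> Q = {}"
    then have "A \<inter> Z = {}" "y \<notin> A" by auto
    then show ?thesis by (simp add: excess_def)
  next
    assume "Q \<subseteq> A"
    then have "card (A \<inter> Z) = K" "x \<in> A" using card_Int_Z_eq by auto
    then show ?thesis by (simp add: excess_def)
  qed
qed

lemma sum_chain_cover: "(\<Sum>A\<in>F. chain_cover A) \<le> 12 * K"
  using sum_only_left[OF finite_Z incomparable_sym[OF Z_x]] sum_only_right[OF finite_Z Z_y]
  unfolding chain_cover_def sum.distrib by linarith

lemma sum_cover: "(\<Sum>A\<in>F. cover A) \<le> 12 * K + 6 * K * (K - 1)"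
  using sum_chain_cover sum_only_pairs[OF finite_Z Z_antichain]
  unfolding cover_def sum.distrib by (rule add_mono)

lemma mixed_Q_le: "K * card (mixed F Q) + (\<Sum>A\<in>F. excess A) \<le> 6 * K * (K + 1)"
proof -
  have fin: "finite (mixed F Q)" and sub: "mixed F Q \<subseteq> F"
    using finite_F by (auto simp: mixed_def)
  have "(\<Sum>A\<in>F. excess A) = (\<Sum>A\<in>mixed F Q. excess A)"
    using excess_not_mixed finite_F sub by (intro sum.mono_neutral_right) auto
  then have "K * card (mixed F Q) + (\<Sum>A\<in>F. excess A) = (\<Sum>A\<in>mixed F Q. K + excess A)"
    by (simp add: sum.distrib)
  also have "\<dots> \<le> (\<Sum>A\<in>mixed F Q. cover A)" by (rule sum_mono) (rule cover_mixed)
  also have "\<dots> \<le> (\<Sum>A\<in>F. cover A)" using finite_F sub by (intro sum_mono2) auto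
  also have "\<dots> \<le> 6 * K * (K + 1)"
    using sum_cover K_pos by (cases K) (auto simp: algebra_simps)
  finally show ?thesis .
qed

lemma mixed_Q_ge: "24 * K + 44 \<le> 5 * card (mixed F Q)"
proof -
  have "24 * card Q < 5 * card (mixed F Q) + 5"
    using spanning x_P y_P Z_P by (intro spanning_mixed) auto
  then show ?thesis unfolding card_Q by simp
qed

text \<open>Dropping the excess leaves at most \<open>6 * (K + 1)\<close> mixed sets; with
  \<open>mixed_Q_ge\<close> this yields \<open>14 \<le> 6 * K\<close>.\<close>

lemma K_ge_3: "3 \<le> K"
proof -
  have "K * card (mixed F Q) \<le> K * (6 * (K + 1))" using mixed_Q_le by (simp add: algebra_simps)
  then have "card (mixed F Q) \<le> 6 * (K + 1)" using K_pos by simp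
  then show ?thesis using mixed_Q_ge by simp
qed

text \<open>Since \<open>y\<close> forces \<open>x\<close>, a mixed set of \<open>{x, y, z}\<close>
  separates \<open>x\<close> from \<open>z\<close> or \<open>z\<close> from \<open>y\<close>. So
  there are at most \<open>12\<close> of them, against a loss above \<open>72/5\<close>.\<close>

lemma three_toggles:
  assumes "z \<in> Z"
  shows "3 \<le> card (toggles F {x, y, z})"
proof -
  have inc: "incomparable F x z" "incomparable F z y"
    using incomparable_sym[OF Z_x[OF assms]] Z_y[OF assms] by simp_all
  have "mixed F {x, y, z} \<subseteq> only F x z \<union> only F z y"
    using x_in by (auto simp: mixed_def only_def)
  then have "card (mixed F {x, y, z}) \<le> card (only F x z \<union> only F z y)"
    using finite_F by (intro card_mono) (auto simp: only_def)
  also have "\<dots> \<le> card (only F x z) + card (only F z y)" by (rule card_Un_le)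
  also have "\<dots> \<le> 12" using only_le_6[OF inc(1)] only_le_6[OF inc(2)] by simp
  finally have "card (mixed F {x, y, z}) \<le> 12" .
  moreover have "24 * card {x, y, z} < 5 * card (mixed F {x, y, z}) + 5 * card (toggles F {x, y, z})"
    using x_P y_P Z_P assms by (intro mixed_toggles) auto
  moreover have "card {x, y, z} = 3" using x_neq_y assms x_notin_Z y_notin_Z by (metis card_3_iff)
  ultimately show ?thesis by linarith
qed

text \<open>The factors \<open>K - |A \<inter> Z|\<close> and \<open>|A \<inter> Z|\<close> of the
  excess count the \<open>z \<in> Z\<close> outside and inside \<open>A\<close>. Summing over
  \<open>z\<close> first allows the toggles of each \<open>{x, y, z}\<close> to be used
  separately.\<close>

lemma excess_split:
  "(\<Sum>A\<in>F. excess A) =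
     (\<Sum>z\<in>Z. \<Sum>A\<in>{A \<in> F. x \<notin> A \<and> z \<notin> A}. card (A \<inter> Z) - 1)
     + (\<Sum>z\<in>Z. \<Sum>A\<in>{A \<in> F. y \<in> A \<and> z \<in> A}. K - 1 - card (A \<inter> Z))"
proof -
  have "(\<Sum>z\<in>{z \<in> Z. x \<notin> A \<and> z \<notin> A}. card (A \<inter> Z) - 1)
      = (if x \<notin> A then (card (A \<inter> Z) - 1) * (K - card (A \<inter> Z)) else 0)" for A
  proof -
    have "{z \<in> Z. z \<notin> A} = Z - A" by auto
    then show ?thesis using finite_Z by (simp add: card_Diff_subset_Int Int_commute)
  qed
  moreover have "(\<Sum>z\<in>{z \<in> Z. y \<in> A \<and> z \<in> A}. K - 1 - card (A \<inter> Z))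
      = (if y \<in> A then card (A \<inter> Z) * (K - 1 - card (A \<inter> Z)) else 0)" for A
  proof -
    have "{z \<in> Z. z \<in> A} = A \<inter> Z" by auto
    then show ?thesis by simp
  qed
  ultimately show ?thesis
    unfolding sum.swap_restrict[OF finite_Z finite_F, of _ "\<lambda>z A. x \<notin> A \<and> z \<notin> A"]
      sum.swap_restrict[OF finite_Z finite_F, of _ "\<lambda>z A. y \<in> A \<and> z \<in> A"] excess_def
    by (simp add: sum.distrib)
qed

text \<open>For a toggle \<open>B\<close> of \<open>{x, y, z}\<close>, \<open>B\<close> contributes
  \<open>|B \<inter> Z| - 1\<close> to the first sum for \<open>z\<close>, and
  \<open>B \<union> {x, y, z}\<close> contributes \<open>K - 2 - |B \<inter> Z|\<close> to the
  second. Each of the three toggles thus adds at least \<open>K - 3\<close>.\<close>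

lemma excess_ge: "3 * K * (K - 3) \<le> (\<Sum>A\<in>F. excess A)"
proof -
  have "3 * (K - 3) \<le> (\<Sum>A\<in>{A \<in> F. x \<notin> A \<and> z \<notin> A}. card (A \<inter> Z) - 1)
     + (\<Sum>A\<in>{A \<in> F. y \<in> A \<and> z \<in> A}. K - 1 - card (A \<inter> Z))" if z: "z \<in> Z" for z
  proof -
    let ?D = "toggles F {x, y, z}"
    have finD: "finite ?D" using finite_F by (auto simp: toggles_def)
    have inj: "inj_on (\<lambda>B. B \<union> {x, y, z}) ?D"
      by (rule inj_onI) (auto simp: toggles_def)
    have card_B: "card ((B \<union> {x, y, z}) \<inter> Z) = Suc (card (B \<inter> Z))" if "B \<in> ?D" for B
    proof -
      have "(B \<union> {x, y, z}) \<inter> Z = insert z (B \<inter> Z)" using z x_notin_Z y_notin_Z by auto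
      then show ?thesis using that finite_Z by (auto simp: toggles_def)
    qed
    have "(\<Sum>B\<in>?D. card (B \<inter> Z) - 1) \<le> (\<Sum>A\<in>{A \<in> F. x \<notin> A \<and> z \<notin> A}. card (A \<inter> Z) - 1)"
      using finite_F by (intro sum_mono2) (auto simp: toggles_def)
    moreover have "(\<Sum>B\<in>?D. K - 2 - card (B \<inter> Z))
        = (\<Sum>A\<in>(\<lambda>B. B \<union> {x, y, z}) ` ?D. K - 1 - card (A \<inter> Z))"
      unfolding sum.reindex[OF inj] o_def
    proof (intro sum.cong refl)
      fix B assume "B \<in> ?D"
      then show "K - 2 - card (B \<inter> Z) = K - 1 - card ((B \<union> {x, y, z}) \<inter> Z)"
        unfolding card_B[OF \<open>B \<in> ?D\<close>] by simp
    qed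
    moreover have "\<dots> \<le> (\<Sum>A\<in>{A \<in> F. y \<in> A \<and> z \<in> A}. K - 1 - card (A \<inter> Z))"
      using finite_F by (intro sum_mono2) (auto simp: toggles_def)
    \<comment> \<open>Truncated subtraction can only enlarge the right-hand side here.\<close>
    moreover have "(\<Sum>B\<in>?D. K - 3) \<le> (\<Sum>B\<in>?D. (card (B \<inter> Z) - 1) + (K - 2 - card (B \<inter> Z)))"
      by (rule sum_mono) simp
    moreover have "3 * (K - 3) \<le> (\<Sum>B\<in>?D. K - 3)"
      using three_toggles[OF z] by simp
    ultimately show ?thesis unfolding sum.distrib by linarith
  qed
  then have "(\<Sum>z\<in>Z. 3 * (K - 3)) \<le> (\<Sum>A\<in>F. excess A)"
    unfolding excess_split sum.distrib[symmetric] by (rule sum_mono)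
  then show ?thesis by (simp add: algebra_simps)
qed

text \<open>The excess lowers the number of mixed sets to at most \<open>3 * K + 15\<close>, and
  \<open>mixed_Q_ge\<close> then gives \<open>9 * K \<le> 31\<close>.\<close>

lemma K_eq_3: "K = 3"
proof -
  have "K * card (mixed F Q) + 3 * K * (K - 3) \<le> 6 * K * (K + 1)"
    using mixed_Q_le excess_ge by linarith
  then have "K * (card (mixed F Q) + 3 * (K - 3)) \<le> K * (6 * (K + 1))" by (simp add: algebra_simps)
  then have "card (mixed F Q) + 3 * (K - 3) \<le> 6 * (K + 1)" using K_pos by simp
  then show ?thesis using mixed_Q_ge K_ge_3 by simp
qed

end

context wide_chain
begin

text \<open>For \<open>K = 3\<close> the total cover is at most \<open>72\<close>, while at least
  \<open>24\<close> mixed sets have cover at least \<open>3\<close> each: there is no slack.\<close>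

lemma cover_eq_3:
  assumes "A \<in> mixed F Q"
  shows "cover A = 3"
proof (rule ccontr)
  assume "cover A \<noteq> 3"
  have ge: "3 \<le> cover B" if "B \<in> mixed F Q" for B
    using cover_mixed[OF that] K_eq_3 by simp
  have fin: "finite (mixed F Q)" and sub: "mixed F Q \<subseteq> F"
    using finite_F by (auto simp: mixed_def)
  have "(\<Sum>B\<in>mixed F Q. 3) < (\<Sum>B\<in>mixed F Q. cover B)"
  proof (rule sum_strict_mono_ex1)
    have "3 < cover A" using ge[OF assms] \<open>cover A \<noteq> 3\<close> by linarith
    then show "\<exists>B\<in>mixed F Q. 3 < cover B" using assms by blast
  qed (use fin ge in blast)+
  also have "\<dots> \<le> (\<Sum>B\<in>F. cover B)" using finite_F sub by (intro sum_mono2) auto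
  also have "\<dots> \<le> 72" using sum_cover K_eq_3 by simp
  finally show False using mixed_Q_ge K_eq_3 by simp
qed

text \<open>The chain cover of \<open>A\<close> is already \<open>3\<close>, so the remaining part
  \<open>t * (3 - t)\<close> of its cover vanishes, where \<open>t = |A \<inter> Z|\<close>.\<close>

lemma Int_Z_empty_or_full:
  assumes "A \<in> F" "x \<in> A" "y \<notin> A"
  shows "A \<inter> Z = {} \<or> Z \<subseteq> A"
proof -
  have "A \<in> mixed F Q" using assms by (auto simp: mixed_def)
  then have "cover A = 3" by (rule cover_eq_3)
  moreover have "card (A \<inter> Z) \<le> 3" using card_Int_Z_le[of A] K_eq_3 by simp
  ultimately have "card (A \<inter> Z) * (3 - card (A \<inter> Z)) = 0"
    using assms K_eq_3 by (simp add: cover_def chain_cover_def)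
  then show ?thesis using card_Int_Z_0[of A] card_Int_Z_eq[of A] K_eq_3 \<open>card (A \<inter> Z) \<le> 3\<close> by auto
qed

text \<open>The sets in \<open>?N\<close> have chain cover \<open>3\<close>, and the toggles of
  \<open>x\<close> and \<open>y\<close> provide at least \<open>10\<close> of them. The other mixed
  sets have chain cover at least \<open>1\<close>, so the total is at least
  \<open>3 * 10 + 14 = 44\<close>, above the bound \<open>36\<close>.\<close>

lemma wide_chain_False: False
proof -
  let ?M0 = "{A \<in> F. x \<notin> A \<and> Z \<subseteq> A}"
  let ?M1 = "{A \<in> F. x \<in> A \<and> y \<notin> A}"
  let ?M2 = "{A \<in> F. y \<in> A \<and> A \<inter> Z = {}}"
  let ?N = "?M0 \<union> ?M1 \<union> ?M2"
  have fin: "finite ?M0" "finite ?M1" "finite ?M2" "finite (mixed F Q)"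
    using finite_F by (auto simp: mixed_def)
  have disj: "?M0 \<inter> ?M1 = {}" "(?M0 \<union> ?M1) \<inter> ?M2 = {}"
    using x_in Z_nonempty by auto
  have card_N: "card ?N = card ?M0 + card ?M1 + card ?M2"
    using fin disj by (simp add: card_Un_disjoint)
  have N_mixed: "?N \<subseteq> mixed F Q"
    using x_in Z_nonempty by (auto simp: mixed_def)

  \<comment> \<open>A toggle \<open>B\<close> misses \<open>y\<close>, so \<open>insert x B\<close>
    meets \<open>Z\<close> in nothing or in all of it. It is chosen in the first case and
    \<open>B\<close> in the second; membership of \<open>x\<close> in the image tells the cases
    apart.\<close>
  have "card (toggles F {x}) \<le> card (?M0 \<union> {A \<in> ?M1. A \<inter> Z = {}})"
  proof (rule card_inj_on_le[where f = "\<lambda>B. if B \<inter> Z = {} then insert x B else B"])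
    show "inj_on (\<lambda>B. if B \<inter> Z = {} then insert x B else B) (toggles F {x})"
      by (rule inj_onI) (auto simp: toggles_def split: if_splits)
    have "(if B \<inter> Z = {} then insert x B else B) \<in> ?M0 \<union> {A \<in> ?M1. A \<inter> Z = {}}"
      if B: "B \<in> toggles F {x}" for B
    proof -
      have b: "B \<in> F" "x \<notin> B" "insert x B \<in> F" using B by (auto simp: toggles_def)
      then have "y \<notin> B" using x_in by blast
      then show ?thesis using b Int_Z_empty_or_full[of "insert x B"] x_neq_y x_notin_Z by auto
    qed
    then show "(\<lambda>B. if B \<inter> Z = {} then insert x B else B) ` toggles F {x} \<subseteq> ?M0 \<union> {A \<in> ?M1. A \<inter> Z = {}}"
      by blast
  qed (use finite_F in auto)
  then have x5: "5 \<le> card ?M0 + card {A \<in> ?M1. A \<inter> Z = {}}"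
    using five_toggles[OF x_P] card_Un_le[of ?M0 "{A \<in> ?M1. A \<inter> Z = {}}"] by linarith

  \<comment> \<open>Here \<open>x \<in> B\<close> because \<open>insert y B\<close> contains
    \<open>x\<close>, so \<open>B\<close> itself meets \<open>Z\<close> in nothing or in all of it,
    and \<open>y\<close> tells the cases apart.\<close>
  have "card (toggles F {y}) \<le> card ({A \<in> ?M1. Z \<subseteq> A} \<union> ?M2)"
  proof (rule card_inj_on_le[where f = "\<lambda>B. if B \<inter> Z = {} then insert y B else B"])
    show "inj_on (\<lambda>B. if B \<inter> Z = {} then insert y B else B) (toggles F {y})"
      by (rule inj_onI) (auto simp: toggles_def split: if_splits)
    have "(if B \<inter> Z = {} then insert y B else B) \<in> {A \<in> ?M1. Z \<subseteq> A} \<union> ?M2"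
      if B: "B \<in> toggles F {y}" for B
    proof -
      have b: "B \<in> F" "y \<notin> B" "insert y B \<in> F" using B by (auto simp: toggles_def)
      then have "x \<in> B" using x_in[of "insert y B"] x_neq_y by auto
      then show ?thesis using b Int_Z_empty_or_full[of B] y_notin_Z by auto
    qed
    then show "(\<lambda>B. if B \<inter> Z = {} then insert y B else B) ` toggles F {y} \<subseteq> {A \<in> ?M1. Z \<subseteq> A} \<union> ?M2"
      by blast
  qed (use finite_F in auto)
  then have y5: "5 \<le> card {A \<in> ?M1. Z \<subseteq> A} + card ?M2"
    using five_toggles[OF y_P] card_Un_le[of "{A \<in> ?M1. Z \<subseteq> A}" ?M2] by linarith

  have "card {A \<in> ?M1. A \<inter> Z = {}} + card {A \<in> ?M1. Z \<subseteq> A}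
      = card ({A \<in> ?M1. A \<inter> Z = {}} \<union> {A \<in> ?M1. Z \<subseteq> A})"
    using finite_F Z_nonempty by (intro card_Un_disjoint[symmetric]) auto
  also have "\<dots> \<le> card ?M1" using fin by (intro card_mono) auto
  finally have N10: "10 \<le> card ?N" using x5 y5 card_N by linarith

  have "chain_cover A \<ge> 3" if "A \<in> ?N" for A
    using that x_in[of A] card_Int_Z_eq[of A] K_eq_3 Int_Z_empty_or_full[of A]
    by (auto simp: chain_cover_def)
  then have "(\<Sum>A\<in>?N. 3) \<le> (\<Sum>A\<in>?N. chain_cover A)" by (intro sum_mono) auto
  moreover have "chain_cover A \<ge> 1" if "A \<in> mixed F Q - ?N" for A
  proof -
    have "A \<in> mixed F Q" using that by simp
    then show ?thesis by (cases rule: mixed_Q_cases) (use K_eq_3 card_Int_Z_le[of A] in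
        \<open>auto simp: chain_cover_def\<close>)
  qed
  then have "(\<Sum>A\<in>mixed F Q - ?N. 1) \<le> (\<Sum>A\<in>mixed F Q - ?N. chain_cover A)" by (intro sum_mono) auto
  moreover have "(\<Sum>A\<in>mixed F Q - ?N. chain_cover A) + (\<Sum>A\<in>?N. chain_cover A)
      = (\<Sum>A\<in>mixed F Q. chain_cover A)"
    using N_mixed fin by (intro sum.subset_diff[symmetric]) auto
  moreover have "\<dots> \<le> (\<Sum>A\<in>F. chain_cover A)"
    using finite_F by (intro sum_mono2) (auto simp: mixed_def)
  moreover have "card (mixed F Q - ?N) = card (mixed F Q) - card ?N"
    using N_mixed fin by (intro card_Diff_subset) auto
  ultimately have "3 * card ?N + (card (mixed F Q) - card ?N) \<le> 36"
    using sum_chain_cover K_eq_3 by simp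
  moreover have "24 \<le> card (mixed F Q)" using mixed_Q_ge K_eq_3 by simp
  ultimately show False using N10 by linarith
qed

end

section \<open>Transitivity of incomparability\<close>

context irreducible_family
begin

lemma incomparable_in_P: "incomparable F i j \<Longrightarrow> i \<in> P \<and> j \<in> P"
  using F_Pow by (auto simp: incomparable_def only_def)

text \<open>\<open>Z\<close> is a maximal antichain containing \<open>z\<close> among the rows
  incomparable to both \<open>x\<close> and \<open>y\<close>. A row violating
  \<open>spanning\<close> could be added to it.\<close>

lemma no_wide_chain:
  assumes "x \<noteq> y" "only F y x = {}" "incomparable F z x" "incomparable F z y"
  shows False
proof -
  define anti where "anti Z \<longleftrightarrow> z \<in> Z \<and> (\<forall>u\<in>Z. incomparable F u x \<and> incomparable F u y)
    \<and> (\<forall>u\<in>Z. \<forall>v\<in>Z. u \<noteq> v \<longrightarrow> incomparable F u v)" for Z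
  have "{Z. anti Z} \<subseteq> Pow P" using incomparable_in_P by (auto simp: anti_def)
  then have "finite {Z. anti Z}" using finite_P by (meson finite_Pow_iff finite_subset)
  moreover have "anti {z}" using assms by (auto simp: anti_def)
  ultimately obtain Z where Z: "anti Z" and max: "\<And>Z'. anti Z' \<Longrightarrow> Z \<subseteq> Z' \<Longrightarrow> Z = Z'"
    using finite_has_maximal[of "{Z. anti Z}"] by blast
  have Zx: "incomparable F u x" and Zy: "incomparable F u y" if "u \<in> Z" for u
    using Z that by (auto simp: anti_def)
  have sp: "\<exists>q\<in>{x, y} \<union> Z. \<not> incomparable F w q" if "w \<in> P - ({x, y} \<union> Z)" for w
  proof (rule ccontr)
    assume "\<not> ?thesis"
    then have w: "\<And>q. q \<in> {x, y} \<union> Z \<Longrightarrow> incomparable F w q" by blast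
    then have w': "\<And>q. q \<in> Z \<Longrightarrow> incomparable F q w" using incomparable_sym[of F w] by blast
    have "anti (insert w Z)" using Z w w' by (simp add: anti_def)
    then show False using max[of "insert w Z"] that by auto
  qed
  have P: "x \<in> P" "y \<in> P" "Z \<subseteq> P" using assms(3,4) Zx incomparable_in_P by auto
  have Z0: "Z \<noteq> {}" "\<And>u v. u \<in> Z \<Longrightarrow> v \<in> Z \<Longrightarrow> u \<noteq> v \<Longrightarrow> incomparable F u v"
    using Z by (auto simp: anti_def)
  interpret wide_chain P F x y Z
    by unfold_locales (fact assms(1) assms(2) P Z0 Zx Zy sp)+
  show False by (rule wide_chain_False)
qed

lemma incomparable_trans:
  assumes "incomparable F x z" "incomparable F z y" "x \<noteq> y"
  shows "incomparable F x y"
proof (rule ccontr)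
  assume "\<not> ?thesis"
  then consider "only F x y = {}" | "only F y x = {}" by (auto simp: incomparable_def)
  then show False
  proof cases
    case 1
    then show False
      using no_wide_chain[of y x z] assms incomparable_sym[OF assms(1)] by auto
  next
    case 2
    then show False
      using no_wide_chain[of x y z] assms incomparable_sym[OF assms(1)] by auto
  qed
qed

end

section \<open>Counting the mixed sets of an incomparability class\<close>

text \<open>\<open>k\<close> is the size of the class and \<open>N\<close> the number of its mixed
  sets. The first two hypotheses exclude \<open>k \<le> 4\<close>. For \<open>k = 5\<close> they
  leave \<open>N \<ge> 24\<close>, and the third would need \<open>124 \<le> 120\<close>.\<close>

lemma antichain_arith:
  fixes k N :: nat
  assumes "24 * k \<le> 5 * N + 4" "N + 2 \<le> 2 ^ k"
    and "(k - 1) * N + (k - 3) * (N - 2 * k) \<le> 6 * k * (k - 1)" 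
  shows False
proof -
  consider "k = 0" | "k = 1" | "k = 2" | "k = 3" | "k = 4" | "k = 5" | "6 \<le> k" by linarith
  then show False
  proof cases
    case 6
    then have "24 \<le> N" using assms(1) by presburger
    then show False using assms(3) 6 by simp
  next
    case 7
    \<comment> \<open>Writing \<open>k = a + 6\<close> and \<open>N = 2 * k + b\<close> removes all
      subtractions; then \<open>(14 * a + 80) * (2 * a + 8)\<close> would be at most
      \<open>20 * (a + 5) * (a + 6)\<close>.\<close>
    then obtain a where a: "k = a + 6" by (metis add.commute le_Suc_ex)
    have "2 * k \<le> N" using assms(1) 7 by linarith
    then obtain b where b: "N = 2 * k + b" using le_Suc_ex by blast
    have 3: "(a + 5) * (2 * a + 12 + b) + (a + 3) * b \<le> 6 * (a + 6) * (a + 5)"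
      using assms(3) by (simp add: a b algebra_simps)
    have 1: "14 * a + 80 \<le> 5 * b" using assms(1) by (simp add: a b)
    have "(14 * a + 80) * (2 * a + 8) \<le> 5 * b * (2 * a + 8)" using 1 by (rule mult_right_mono) simp
    then show False using 3 by (simp add: algebra_simps)
  qed (use assms in auto)
qed

lemma card_singletons_cosingletons:
  assumes "finite M" "M \<noteq> {}"
  shows "card {T. T \<subseteq> M \<and> (card T = 1 \<or> card T = card M - 1)} \<le> 2 * card M"
proof -
  have "0 < card M" using assms by (simp add: card_gt_0_iff)
  have "T \<in> (\<lambda>u. {u}) ` M \<union> (\<lambda>u. M - {u}) ` M"
    if T: "T \<subseteq> M" "card T = 1 \<or> card T = card M - 1" for T
    using T(2)
  proof
    assume "card T = 1"
    then obtain u where "T = {u}" using card_1_singletonE by blast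
    then show ?thesis using T by blast
  next
    assume "card T = card M - 1"
    moreover have "card (M - T) = card M - card T"
      using T assms finite_subset by (intro card_Diff_subset) auto
    ultimately have "card (M - T) = 1" using \<open>0 < card M\<close> by simp
    then obtain u where "M - T = {u}" using card_1_singletonE by blast
    then have "T = M - {u}" "u \<in> M" using T by blast+
    then show ?thesis by blast
  qed
  then have "{T. T \<subseteq> M \<and> (card T = 1 \<or> card T = card M - 1)} \<subseteq> (\<lambda>u. {u}) ` M \<union> (\<lambda>u. M - {u}) ` M"
    by blast
  then have "card {T. T \<subseteq> M \<and> (card T = 1 \<or> card T = card M - 1)}
      \<le> card ((\<lambda>u. {u}) ` M \<union> (\<lambda>u. M - {u}) ` M)"
    by (rule card_mono[rotated]) (simp add: assms)
  also have "\<dots> \<le> card ((\<lambda>u. {u}) ` M) + card ((\<lambda>u. M - {u}) ` M)" by (rule card_Un_le)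
  also have "\<dots> \<le> card M + card M" by (rule add_mono) (rule card_image_le[OF assms(1)])+
  finally show ?thesis by simp
qed

context irreducible_family
begin

lemma irreducible_false: False
proof -
  obtain p where p: "p \<in> P" using nonempty by blast
  define M where "M = insert p {q. incomparable F q p}"
  have MP: "M \<subseteq> P" using p incomparable_in_P by (auto simp: M_def)
  then have finM: "finite M" using finite_P finite_subset by blast
  have anti: "incomparable F u v" if "u \<in> M" "v \<in> M" "u \<noteq> v" for u v
    using that incomparable_trans[of u p v] incomparable_sym[of F u p] incomparable_sym[of F v p]
    by (auto simp: M_def)
  have out: "\<not> incomparable F w q" if "w \<notin> M" "q \<in> M" for w q
  proof
    assume "incomparable F w q"
    then have "incomparable F w p"
      using that incomparable_trans[of w q p] by (auto simp: M_def)
    then show False using that by (simp add: M_def)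
  qed
  let ?k = "card M" and ?N = "card (mixed F M)"
  have fin: "finite (mixed F M)" using finite_F by (auto simp: mixed_def)
  have pM: "p \<in> M" by (simp add: M_def)
  then have "M \<noteq> {}" by blast
  have "\<exists>q\<in>M. \<not> incomparable F w q" if "w \<in> P - M" for w
    using that out[of w p] pM by blast
  then have "24 * ?k < 5 * ?N + 5" by (rule spanning_mixed[OF MP \<open>M \<noteq> {}\<close>])
  then have 1: "24 * ?k \<le> 5 * ?N + 4" by simp
  \<comment> \<open>Mixed sets are determined by their trace on \<open>M\<close>. For
    \<open>w \<in> A\<close> outside \<open>M\<close>, \<open>A\<close> shows that every set with
    \<open>v\<close> contains \<open>w\<close>. If some set had \<open>u\<close> but not
    \<open>w\<close>, then \<open>w\<close> would force \<open>u\<close>, hence \<open>v\<close>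
    would force \<open>u\<close>, although they are incomparable. So \<open>u\<close> forces
    \<open>w\<close>, and \<open>u \<in> A'\<close>.\<close>
  have sub: "w \<in> A'" if AA': "A \<in> mixed F M" "A' \<in> mixed F M" "A \<inter> M = A' \<inter> M" "w \<in> A" for A A' w
  proof (cases "w \<in> M")
    case True
    then show ?thesis using that by blast
  next
    case False
    obtain u v where uv: "u \<in> A \<inter> M" "v \<in> M" "v \<notin> A" using AA'(1) unfolding mixed_def by blast
    then have "A \<in> only F w v" using that by (auto simp: only_def mixed_def)
    then have "only F v w = {}" using out[OF False uv(2)] by (auto simp: incomparable_def)
    have "only F u w = {}"
    proof (rule ccontr)
      assume "only F u w \<noteq> {}"
      then have "only F w u = {}" using out[of w u] False uv by (auto simp: incomparable_def)
      then have "only F v u = {}" using \<open>only F v w = {}\<close> by (auto simp: only_def)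
      then show False using anti[of u v] uv by (auto simp: incomparable_def)
    qed
    moreover have "u \<in> A'" "A' \<in> F" using that uv by (auto simp: mixed_def)
    ultimately show ?thesis by (auto simp: only_def)
  qed
  have inj: "inj_on (\<lambda>A. A \<inter> M) (mixed F M)"
    by (rule inj_onI) (use sub in blast)
  have "(\<lambda>A. A \<inter> M) ` mixed F M \<subseteq> Pow M - {{}, M}" by (auto simp: mixed_def)
  then have "?N \<le> card (Pow M - {{}, M})"
    using inj finM by (metis card_image card_mono finite_Diff finite_Pow_iff)
  also have "\<dots> = 2 ^ ?k - 2"
    using finM \<open>M \<noteq> {}\<close> by (subst card_Diff_subset) (auto simp: card_Pow)
  finally have "?N \<le> 2 ^ ?k - 2" .
  moreover have "(2::nat) \<le> 2 ^ ?k"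
    using finM \<open>M \<noteq> {}\<close> power_increasing[of 1 ?k "2::nat"] by (simp add: card_gt_0_iff Suc_leI)
  ultimately have 2: "?N + 2 \<le> 2 ^ ?k" by linarith

  \<comment> \<open>A trace of size \<open>t\<close> separates \<open>t * (k - t)\<close> pairs:
    \<open>k - 1\<close> for the extreme sizes, at least
    \<open>2 * (k - 2) = (k - 1) + (k - 3)\<close> otherwise. By injectivity at most
    \<open>2 * k\<close> mixed sets have extreme traces.\<close>
  let ?L = "{A \<in> mixed F M. card (A \<inter> M) = 1 \<or> card (A \<inter> M) = ?k - 1}"
  have "?L \<subseteq> mixed F M" by blast
  then have card_L: "card ?L = card ((\<lambda>A. A \<inter> M) ` ?L)"
    by (rule card_image[OF inj_on_subset[OF inj], symmetric])
  have "(\<lambda>A. A \<inter> M) ` ?L \<subseteq> {T. T \<subseteq> M \<and> (card T = 1 \<or> card T = ?k - 1)}" by blast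
  then have "card ((\<lambda>A. A \<inter> M) ` ?L) \<le> card {T. T \<subseteq> M \<and> (card T = 1 \<or> card T = ?k - 1)}"
    by (rule card_mono[rotated]) (simp add: finM)
  also have "\<dots> \<le> 2 * ?k" using finM \<open>M \<noteq> {}\<close> by (rule card_singletons_cosingletons)
  finally have L: "card ?L \<le> 2 * ?k" using card_L by linarith
  have "card (mixed F M - ?L) = ?N - card ?L" using fin by (intro card_Diff_subset) auto
  then have rest: "?N - 2 * ?k \<le> card (mixed F M - ?L)" using L by linarith

  let ?c = "\<lambda>A. card (A \<inter> M) * (?k - card (A \<inter> M))"
  have c: "?k - 1 + (if A \<in> ?L then 0 else ?k - 3) \<le> ?c A" if A: "A \<in> mixed F M" for A
  proof -
    have "A \<inter> M \<noteq> {}" "A \<inter> M \<subset> M" using A by (auto simp: mixed_def)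
    then have "1 \<le> card (A \<inter> M)" "card (A \<inter> M) < ?k"
      using finM by (auto simp: Suc_leI card_gt_0_iff psubset_card_mono)
    \<comment> \<open>With these parameters the product is
      \<open>(a + 1) * (b + 1) = (k - 1) + a * b\<close>.\<close>
    then obtain a b where ab: "card (A \<inter> M) = a + 1" "?k = a + b + 2"
      using that[of "card (A \<inter> M) - 1" "?k - card (A \<inter> M) - 1"] by simp
    show ?thesis
    proof (cases "A \<in> ?L")
      case True
      then show ?thesis by (simp add: ab)
    next
      case False
      then have "a \<noteq> 0" "b \<noteq> 0" using A ab by auto
      then obtain a' b' where "a = Suc a'" "b = Suc b'" by (metis not0_implies_Suc)
      then show ?thesis using False by (simp add: ab)
    qed
  qed
  have "(?k - 1) * ?N + (?k - 3) * (?N - 2 * ?k) \<le> (?k - 1) * ?N + (?k - 3) * card (mixed F M - ?L)"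
    using rest by simp
  also have "\<dots> = (\<Sum>A\<in>mixed F M. ?k - 1 + (if A \<in> ?L then 0 else ?k - 3))"
  proof -
    have "(\<Sum>A\<in>mixed F M. if A \<in> ?L then 0 else ?k - 3) = (\<Sum>A\<in>mixed F M - ?L. ?k - 3)"
      using fin by (intro sum.mono_neutral_cong_right) auto
    then show ?thesis unfolding sum.distrib by simp
  qed
  also have "\<dots> \<le> (\<Sum>A\<in>mixed F M. ?c A)" by (rule sum_mono) (rule c)
  also have "\<dots> \<le> (\<Sum>A\<in>F. ?c A)" using finite_F by (intro sum_mono2) (auto simp: mixed_def)
  also have "\<dots> \<le> 6 * ?k * (?k - 1)" using finM anti by (rule sum_only_pairs)
  finally show False using antichain_arith[OF 1 2] by simp
qed

end

text \<open>Induction on \<open>|P|\<close>: a cheap set \<open>S\<close> to delete exists, as the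
  family would otherwise be irreducible. The constant \<open>5\<close> comes from the single set
  possible on no rows.\<close>

theorem card_thin_family_le:
  assumes "thin_family P F"
  shows "5 * card F \<le> 24 * card P + 5"
  using assms
proof (induction "card P" arbitrary: P F rule: less_induct)
  case less
  interpret thin_family P F by (fact less.prems)
  show ?case
  proof (cases "P = {}")
    case True
    then have "F \<subseteq> {{}}" using F_Pow by auto
    then have "card F \<le> card {{} :: 'a set}" by (intro card_mono) auto
    then show ?thesis by simp
  next
    case False
    have "\<exists>S. S \<subseteq> P \<and> S \<noteq> {} \<and> 5 * card F \<le> 24 * card S + 5 * card ((\<lambda>A. A - S) ` F)"
    proof (rule ccontr)
      assume "\<not> ?thesis"
      then interpret irreducible_family P F by unfold_locales (use False in \<open>auto simp: not_le\<close>)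
      show False by (rule irreducible_false)
    qed
    then obtain S where S: "S \<subseteq> P" "S \<noteq> {}"
      "5 * card F \<le> 24 * card S + 5 * card ((\<lambda>A. A - S) ` F)" by blast
    have finS: "finite S" using S finite_P finite_subset by blast
    have "card P = card (P - S) + card S"
      using S finS finite_P by (simp add: card_Diff_subset card_mono)
    moreover have "0 < card S" using S finS by (simp add: card_gt_0_iff)
    ultimately have "5 * card ((\<lambda>A. A - S) ` F) \<le> 24 * card (P - S) + 5"
      by (intro less.hyps thin_family_deletion) linarith
    then show ?thesis using S(3) \<open>card P = _\<close> by linarith
  qed
qed

section \<open>Matrices and families\<close>

text \<open>\<open>submatrix\<close> keeps the chosen indices in increasing order. The permutation
  \<open>f\<close> swaps the rows when \<open>k < i\<close>, and \<open>g\<close> sends the position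
  \<open>c0\<close> of \<open>j0\<close> to the last column.\<close>

lemma configuration_F_0p10I:
  assumes "i < dim_row A" "k < dim_row A"
    and p: "p \<le> card {j. j < dim_col A \<and> A $$ (i, j) = 1 \<and> A $$ (k, j) = 0}"
    and j0: "j0 < dim_col A" "A $$ (i, j0) = 0" "A $$ (k, j0) = 1"
  shows "F_0p10 p \<prec> A"
proof -
  obtain J' where J': "J' \<subseteq> {j. j < dim_col A \<and> A $$ (i, j) = 1 \<and> A $$ (k, j) = 0}" "card J' = p" "finite J'"
    using obtain_subset_with_card_n[OF p] by blast
  let ?I = "{i, k}" and ?J = "insert j0 J'"
  have j0J: "j0 \<notin> J'" using J' j0 by auto
  have "i \<noteq> k" using j0 by auto
  have "{r. r < dim_row A \<and> r \<in> ?I} = ?I" "{c. c < dim_col A \<and> c \<in> ?J} = ?J"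
    using assms J' by auto
  then have dims: "card {r. r < dim_row A \<and> r \<in> ?I} = 2" "card {c. c < dim_col A \<and> c \<in> ?J} = p + 1"
    using \<open>i \<noteq> k\<close> j0J J' by auto
  have cJ: "card ?J = p + 1" using j0J J' by simp
  define c0 where "c0 = card {a \<in> ?J. a < j0}"
  have pick_c0: "pick ?J c0 = j0" unfolding c0_def by (rule pick_card_in_set) simp
  have "{a \<in> ?J. a < j0} \<subset> ?J" by auto
  then have "c0 < p + 1" unfolding c0_def cJ[symmetric] using J' by (intro psubset_card_mono) auto
  have pick_J: "pick ?J c \<in> J'" if "c < p + 1" "c \<noteq> c0" for c
  proof -
    have "pick ?J c \<in> ?J" using that cJ by (intro pick_in_set_le) simp
    moreover have "pick ?J c \<noteq> j0"
    proof
      assume "pick ?J c = j0"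
      moreover have "card {a \<in> ?J. a < pick ?J c} = c" using that cJ by (intro card_pick_le) simp
      ultimately show False using that by (simp add: c0_def)
    qed
    ultimately show ?thesis by blast
  qed
  define f where "f = (if i < k then id else transpose 0 (1::nat))"
  have f: "f permutes {..<2}" by (auto simp: f_def permutes_swap_id)
  have pick_I: "pick ?I r = (if f r = 0 then i else k)" if "r < 2" for r
  proof (cases "i < k")
    case True
    then have a: "{a \<in> ?I. a < i} = {}" "{a \<in> ?I. a < k} = {i}" by auto
    have "pick ?I 0 = i" "pick ?I 1 = k"
      using pick_card_in_set[of i ?I] pick_card_in_set[of k ?I] unfolding a
      by (simp_all del: pick.simps)
    moreover have "r = 0 \<or> r = 1" using that by linarith
    ultimately show ?thesis using True by (auto simp: f_def simp del: pick.simps)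
  next
    case False
    then have a: "{a \<in> ?I. a < k} = {}" "{a \<in> ?I. a < i} = {k}" using \<open>i \<noteq> k\<close> by auto
    have "pick ?I 0 = k" "pick ?I 1 = i"
      using pick_card_in_set[of i ?I] pick_card_in_set[of k ?I] unfolding a
      by (simp_all del: pick.simps)
    moreover have "r = 0 \<or> r = 1" using that by linarith
    ultimately show ?thesis using False by (auto simp: f_def simp del: pick.simps)
  qed
  define g where "g = transpose c0 p"
  have g: "g permutes {..<p + 1}" using \<open>c0 < p + 1\<close> by (auto simp: g_def intro!: permutes_swap_id)
  have "submatrix A ?I ?J = mat 2 (p + 1) (\<lambda>(r, c). F_0p10 p $$ (f r, g c))"
  proof (rule eq_matI)
    fix r c assume "r < dim_row (mat 2 (p + 1) (\<lambda>(r, c). F_0p10 p $$ (f r, g c)))"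
      "c < dim_col (mat 2 (p + 1) (\<lambda>(r, c). F_0p10 p $$ (f r, g c)))"
    then have rc: "r < 2" "c < p + 1" by auto
    then have fg: "f r < 2" "g c < p + 1" using permutes_in_image[OF f] permutes_in_image[OF g] by auto
    have gc: "g c < p \<longleftrightarrow> c \<noteq> c0"
      using \<open>c0 < p + 1\<close> rc by (auto simp: g_def transpose_def)
    have "submatrix A ?I ?J $$ (r, c) = A $$ (pick ?I r, pick ?J c)"
      using rc dims by (intro submatrix_index) auto
    also have "\<dots> = F_0p10 p $$ (f r, g c)"
      using pick_I[OF rc(1)] pick_J[OF rc(2)] pick_c0 J' j0 fg gc
      by (cases "c = c0") (auto simp: F_0p10_def)
    finally show "submatrix A ?I ?J $$ (r, c) = mat 2 (p + 1) (\<lambda>(r, c). F_0p10 p $$ (f r, g c)) $$ (r, c)"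
      using rc by simp
  qed (use dims in \<open>simp_all add: dim_submatrix\<close>)
  moreover have "dim_row (F_0p10 p) = 2" "dim_col (F_0p10 p) = p + 1" by (simp_all add: F_0p10_def)
  ultimately show ?thesis
    unfolding configuration_def row_col_permutation_def using f g by metis
qed

lemma configuration_F_0p10E:
  assumes "F_0p10 p \<prec> A"
  obtains i k j0 where "i < dim_row A" "k < dim_row A"
    "p \<le> card {j. j < dim_col A \<and> A $$ (i, j) = 1 \<and> A $$ (k, j) = 0}"
    "j0 < dim_col A" "A $$ (i, j0) = 0" "A $$ (k, j0) = 1"
proof -
  obtain I J f g where f: "f permutes {..<2}" and g: "g permutes {..<p + 1}"
    and sub: "submatrix A I J = mat 2 (p + 1) (\<lambda>(r, c). F_0p10 p $$ (f r, g c))"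
    using assms unfolding configuration_def row_col_permutation_def by (auto simp: F_0p10_def)
  \<comment> \<open>\<open>J\<close> may be infinite; its part \<open>?S\<close> within the matrix
    has size \<open>p + 1\<close>, which bounds the arguments of \<open>pick\<close>.\<close>
  let ?S = "{j. j < dim_col A \<and> j \<in> J}"
  have dims: "card {r. r < dim_row A \<and> r \<in> I} = 2" "card ?S = p + 1"
    using arg_cong[OF sub, of dim_row] arg_cong[OF sub, of dim_col] by (simp_all add: dim_submatrix)
  have entry: "A $$ (pick I r, pick ?S c) = F_0p10 p $$ (f r, g c)" if "r < 2" "c < p + 1" for r c
  proof -
    have "submatrix A I J $$ (r, c) = A $$ (pick I r, pick J c)"
      using that dims by (intro submatrix_index) auto
    moreover have "pick J c = pick ?S c" using that dims by (intro pick_reduce_set) simp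
    ultimately show ?thesis using that by (simp add: sub)
  qed
  define f' where "f' = inv_into UNIV f"
  define g' where "g' = inv_into UNIV g"
  define i where "i = pick I (f' 0)"
  define k where "k = pick I (f' 1)"
  have inv_f: "f (f' r) = r" "f' r < 2" if "r < 2" for r
    using permutes_inverses(1)[OF f] permutes_in_image[OF permutes_inv[OF f], of r] that by (auto simp: f'_def)
  have inv_g: "g (g' c) = c" "g' c < p + 1" if "c < p + 1" for c
    using permutes_inverses(1)[OF g] permutes_in_image[OF permutes_inv[OF g], of c] that by (auto simp: g'_def)
  \<comment> \<open>\<open>h c\<close> is the column of \<open>A\<close> that realizes column
    \<open>c\<close> of \<open>F_0p10 p\<close>; \<open>h p\<close> serves as
    \<open>j0\<close>.\<close>
  define h where "h c = pick ?S (g' c)" for c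
  have row: "A $$ (i, h c) = (if c < p then 1 else 0)" "A $$ (k, h c) = (if c < p then 0 else 1)"
    if "c < p + 1" for c
    using entry[of "f' 0" "g' c"] entry[of "f' 1" "g' c"] inv_f[of 0] inv_f[of 1]
      inv_g[OF that] that by (auto simp: i_def k_def h_def F_0p10_def)
  have h_lt: "h c < dim_col A" if "c < p + 1" for c
    using pick_in_set_le[of "g' c" ?S] inv_g[OF that] dims by (simp add: h_def)
  have "inj_on h {..<p}"
  proof (rule inj_onI)
    fix c d assume cd: "c \<in> {..<p}" "d \<in> {..<p}" "h c = h d"
    then have lt: "g' c < card ?S" "g' d < card ?S" using inv_g dims by auto
    have eq: "g' c = g' d"
      using cd(3) card_pick_le[of "g' c" ?S] card_pick_le[of "g' d" ?S] lt by (simp add: h_def)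
    have "g (g' c) = c" "g (g' d) = d" using inv_g(1) cd by simp_all
    then show "c = d" unfolding eq by simp
  qed
  then have "p = card (h ` {..<p})" by (simp add: card_image)
  also have "\<dots> \<le> card {j. j < dim_col A \<and> A $$ (i, j) = 1 \<and> A $$ (k, j) = 0}"
    using row h_lt by (intro card_mono) auto
  finally show thesis
    using row[of p] h_lt[of p] inv_f dims
    by (intro that[of i k "h p"]) (auto simp: i_def k_def intro!: pick_le)
qed

section \<open>Columns as sets\<close>

definition col_set :: "int mat \<Rightarrow> nat \<Rightarrow> nat set" where
  "col_set A j = {i. i < dim_row A \<and> A $$ (i, j) = 1}"

lemma simple_mat_entry:
  assumes "simple_mat A" "i < dim_row A" "j < dim_col A"
  shows "A $$ (i, j) \<in> {0, 1}"
proof -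
  have "A $$ (i, j) \<in> elements_mat A" using assms by (force simp: elements_mat_def)
  then show ?thesis using assms(1) by (auto simp: simple_mat_def)
qed

lemma inj_on_col_set:
  assumes "simple_mat A"
  shows "inj_on (col_set A) {..<dim_col A}"
proof (rule inj_onI)
  fix j j' assume j: "j \<in> {..<dim_col A}" "j' \<in> {..<dim_col A}" and eq: "col_set A j = col_set A j'"
  have "A $$ (i, j) = A $$ (i, j')" if "i < dim_row A" for i
  proof -
    have "A $$ (i, j) \<in> {0, 1}" "A $$ (i, j') \<in> {0, 1}"
      using assms that j by (simp_all only: simple_mat_entry lessThan_iff)
    moreover have "A $$ (i, j) = 1 \<longleftrightarrow> A $$ (i, j') = 1"
      using eq that by (auto simp: col_set_def)
    ultimately show ?thesis by auto
  qed
  then have "col A j = col A j'" using j by (intro eq_vecI) auto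
  then have "cols A ! j = cols A ! j'" using j by simp
  then show "j = j'"
    using assms j nth_eq_iff_index_eq[of "cols A" j j'] by (simp add: simple_mat_def)
qed

lemma thin_family_col_set:
  assumes "A \<in> Avoid m (F_0p10 7)"
  shows "thin_family {..<m} (col_set A ` {..<dim_col A})" (is "thin_family _ ?F")
proof
  have A: "simple_mat A" "dim_row A = m" "\<not> F_0p10 7 \<prec> A" using assms by (auto simp: Avoid_def)
  fix i k assume ik: "i \<in> {..<m}" "k \<in> {..<m}"
  have zero: "A $$ (l, j) \<noteq> 1 \<longleftrightarrow> A $$ (l, j) = 0" if "l < m" "j < dim_col A" for l j
    using simple_mat_entry[of A l j] A that by auto
  have only: "only ?F a b = col_set A ` {j. j < dim_col A \<and> A $$ (a, j) = 1 \<and> A $$ (b, j) = 0}"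
    if "a < m" "b < m" for a b
    using that A(2) zero by (auto simp: only_def col_set_def)
  show "card (only ?F i k) \<le> 6 \<or> only ?F k i = {}"
  proof (rule ccontr)
    assume neg: "\<not> ?thesis"
    have "card (only ?F i k) \<le> card {j. j < dim_col A \<and> A $$ (i, j) = 1 \<and> A $$ (k, j) = 0}"
      using ik by (simp add: only card_image_le)
    then have "7 \<le> card {j. j < dim_col A \<and> A $$ (i, j) = 1 \<and> A $$ (k, j) = 0}" using neg by linarith
    moreover obtain j0 where "j0 < dim_col A" "A $$ (k, j0) = 1" "A $$ (i, j0) = 0"
      using neg ik by (auto simp: only)
    ultimately show False using configuration_F_0p10I[of i A k 7 j0] A ik by auto
  qed
next
  show "?F \<subseteq> Pow {..<m}" using assms by (auto simp: col_set_def Avoid_def)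
qed simp

lemma forb_F_0p10_7_le: "5 * forb m (F_0p10 7) \<le> 24 * m + 5"
proof -
  have "0 < dim_col (F_0p10 7)" by (simp add: F_0p10_def)
  then obtain A where A: "A \<in> Avoid m (F_0p10 7)" "dim_col A = forb m (F_0p10 7)"
    using forb_attained(1) by blast
  have "card (col_set A ` {..<dim_col A}) = dim_col A"
    using A(1) card_image[OF inj_on_col_set[of A]] by (simp add: Avoid_def)
  then show ?thesis using card_thin_family_le[OF thin_family_col_set[OF A(1)]] A(2) by simp
qed

text \<open>The converse translation, needed for the construction: the sets become columns in an
  arbitrary order.\<close>

lemma family_Avoid:
  assumes "finite F" and sub: "F \<subseteq> Pow {..<m}"
    and only: "\<And>i k. i < m \<Longrightarrow> k < m \<Longrightarrow> card (only F i k) < p \<or> only F k i = {}"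
  shows "\<exists>A \<in> Avoid m (F_0p10 p). dim_col A = card F"
proof -
  obtain xs where xs: "set xs = F" "distinct xs" using assms(1) finite_distinct_list by blast
  define A :: "int mat" where "A = mat m (length xs) (\<lambda>(i, j). if i \<in> xs ! j then 1 else 0)"
  have dim: "dim_row A = m" "dim_col A = length xs" by (simp_all add: A_def)
  have entry: "A $$ (i, j) = (if i \<in> xs ! j then 1 else 0)" if "i < m" "j < length xs" for i j
    using that by (simp add: A_def)
  have "distinct (cols A)"
  proof (subst distinct_conv_nth, intro allI impI notI)
    fix j j' assume j: "j < length (cols A)" "j' < length (cols A)" "j \<noteq> j'" "cols A ! j = cols A ! j'"
    then have lt: "j < length xs" "j' < length xs" using dim by auto
    have "i \<in> xs ! j \<longleftrightarrow> i \<in> xs ! j'" if "i < m" for i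
    proof -
      have "A $$ (i, j) = A $$ (i, j')"
        using j lt that dim by (metis cols_length cols_nth index_col)
      then show ?thesis using that lt by (auto simp: entry split: if_splits)
    qed
    moreover have "xs ! j \<subseteq> {..<m}" "xs ! j' \<subseteq> {..<m}" using sub xs lt nth_mem by blast+
    ultimately have "xs ! j = xs ! j'" by blast
    then show False using xs lt j by (simp add: nth_eq_iff_index_eq)
  qed
  moreover have "elements_mat A \<subseteq> {0, 1}" by (auto simp: elements_mat_def A_def)
  moreover have "\<not> F_0p10 p \<prec> A"
  proof
    assume "F_0p10 p \<prec> A"
    then obtain i k j0 where "i < dim_row A" "k < dim_row A"
      "p \<le> card {j. j < dim_col A \<and> A $$ (i, j) = 1 \<and> A $$ (k, j) = 0}"
      "j0 < dim_col A" and j0: "A $$ (i, j0) = 0" "A $$ (k, j0) = 1"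
      by (rule configuration_F_0p10E)
    then have ik: "i < m" "k < m"
      and p: "p \<le> card {j. j < length xs \<and> A $$ (i, j) = 1 \<and> A $$ (k, j) = 0}"
      and "j0 < length xs"
      unfolding dim by blast+
    let ?J = "{j. j < length xs \<and> A $$ (i, j) = 1 \<and> A $$ (k, j) = 0}"
    have "inj_on ((!) xs) ?J" using xs by (auto simp: inj_on_def nth_eq_iff_index_eq)
    then have "card ?J = card ((!) xs ` ?J)" by (simp add: card_image)
    also have "\<dots> \<le> card (only F i k)"
    proof (rule card_mono)
      show "finite (only F i k)" using assms(1) by (simp add: only_def)
      show "(!) xs ` ?J \<subseteq> only F i k"
        using ik xs by (auto simp: only_def entry split: if_splits)
    qed
    finally have "p \<le> card (only F i k)" using p by simp
    moreover have "xs ! j0 \<in> only F k i"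
      using j0 ik xs \<open>j0 < length xs\<close> by (auto simp: only_def entry split: if_splits)
    ultimately show False using only[OF ik] by auto
  qed
  ultimately have "A \<in> Avoid m (F_0p10 p)" using dim by (simp add: Avoid_def simple_mat_def)
  moreover have "dim_col A = card F" using dim xs distinct_card by metis
  ultimately show ?thesis by blast
qed

section \<open>The construction\<close>

text \<open>The edges of the complete bipartite graph with parts \<open>{0, 4}\<close> and
  \<open>{1, 2, 3}\<close>, plus the second part. Each ordered pair of rows is separated by
  \<open>8\<close> subsets of a \<open>5\<close>-set; omitting two of them leaves the permitted
  \<open>6\<close>.\<close>

definition omitted :: "nat set set" where
  "omitted = {{0, 1}, {0, 2}, {0, 3}, {1, 4}, {2, 4}, {3, 4}, {1, 2, 3}}"

text \<open>The full set is left out because it reappears as the empty set of the next copy.\<close>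

definition block :: "nat set set" where
  "block = Pow {..<5} - insert {..<5} omitted"

lemma sum_omitted:
  "sum f omitted = f {0, 1} + (f {0, 2} + (f {0, 3} + (f {1, 4} + (f {2, 4} + (f {3, 4} + f {1, 2, 3})))))"
  for f :: "nat set \<Rightarrow> nat"
  by (simp add: omitted_def set_eq_subset)

lemma omitted_twice:
  assumes "r < 5" "s < 5" "r \<noteq> s"
  shows "2 \<le> card (only omitted r s)"
proof -
  have "card (only omitted r s) = (\<Sum>A\<in>omitted. if r \<in> A \<and> s \<notin> A then 1 else 0)"
    unfolding only_def card_eq_sum by (rule sum.inter_filter) (simp add: omitted_def)
  moreover have "r = 0 \<or> r = 1 \<or> r = 2 \<or> r = 3 \<or> r = 4" "s = 0 \<or> s = 1 \<or> s = 2 \<or> s = 3 \<or> s = 4"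
    using assms by linarith+
  ultimately show ?thesis using assms(3) unfolding sum_omitted by (elim disjE) simp_all
qed

lemma omitted_subset: "omitted \<subseteq> Pow {..<5}"
  by (auto simp: omitted_def)

lemma card_only_Pow:
  assumes "finite V" "r \<in> V" "s \<in> V" "r \<noteq> s"
  shows "card (only (Pow V) r s) \<le> 2 ^ (card V - 2)"
proof -
  have "only (Pow V) r s \<subseteq> insert r ` Pow (V - {r, s})"
  proof
    fix T assume "T \<in> only (Pow V) r s"
    then have "T = insert r (T - {r})" "T - {r} \<in> Pow (V - {r, s})" by (auto simp: only_def)
    then show "T \<in> insert r ` Pow (V - {r, s})" by blast
  qed
  then have "card (only (Pow V) r s) \<le> card (insert r ` Pow (V - {r, s}))"
    by (rule card_mono[rotated]) (use assms in simp)
  also have "\<dots> \<le> card (Pow (V - {r, s}))" by (rule card_image_le) (use assms in simp)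
  also have "\<dots> = 2 ^ card (V - {r, s})" using assms by (simp add: card_Pow)
  also have "card (V - {r, s}) = card V - 2" using assms by (subst card_Diff_subset) auto
  finally show ?thesis .
qed

lemma card_only_block:
  assumes "r < 5" "s < 5" "r \<noteq> s"
  shows "card (only block r s) \<le> 6"
proof -
  have "only block r s \<subseteq> only (Pow {..<5}) r s - only omitted r s"
    by (auto simp: only_def block_def)
  then have "card (only block r s) \<le> card (only (Pow {..<5}) r s - only omitted r s)"
    by (rule card_mono[rotated]) (simp add: only_def)
  moreover have "card (only (Pow {..<5}) r s - only omitted r s)
      = card (only (Pow {..<5}) r s) - card (only omitted r s)"
    using omitted_subset by (intro card_Diff_subset) (auto simp: only_def omitted_def)
  moreover have "card (only (Pow {..<5}) r s) \<le> 8"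
    using card_only_Pow[of "{..<5}" r s] assms by simp
  ultimately show ?thesis using omitted_twice[OF assms] by linarith
qed

lemma card_block: "card block = 24"
proof -
  \<comment> \<open>The full set is thus not itself omitted, so exactly \<open>8\<close> of the
    \<open>32\<close> subsets are removed.\<close>
  have "\<forall>T\<in>omitted. 0 \<notin> T \<or> 4 \<notin> T" by (simp add: omitted_def)
  moreover have "0 \<in> {..<5::nat}" "4 \<in> {..<5::nat}" by simp_all
  ultimately have "{..<5} \<notin> omitted" by blast
  moreover have fin: "finite omitted" by (simp add: omitted_def)
  moreover have "card omitted = 7" using sum_omitted[of "\<lambda>_. 1"] by simp
  ultimately have "card (insert {..<5} omitted) = 8" by simp
  moreover have "card block = card (Pow {..<5::nat}) - card (insert {..<5} omitted)"
    unfolding block_def using omitted_subset fin by (intro card_Diff_subset) simp_all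
  ultimately show ?thesis by (simp add: card_Pow)
qed

section \<open>Stacking the copies\<close>

definition shifted :: "nat \<Rightarrow> nat set \<Rightarrow> nat set" where
  "shifted b T = {..<5 * b} \<union> (+) (5 * b) ` T"

lemma mem_shifted:
  assumes "T \<subseteq> {..<5}"
  shows "i \<in> shifted b T \<longleftrightarrow> i div 5 < b \<or> i div 5 = b \<and> i mod 5 \<in> T"
proof -
  have i: "i = 5 * (i div 5) + i mod 5" by simp
  have "i \<in> (+) (5 * b) ` T \<longleftrightarrow> i div 5 = b \<and> i mod 5 \<in> T"
  proof
    assume "i \<in> (+) (5 * b) ` T"
    then obtain t where "i = 5 * b + t" "t \<in> T" by blast
    moreover have "t < 5" using \<open>t \<in> T\<close> assms by blast
    ultimately show "i div 5 = b \<and> i mod 5 \<in> T" by simp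
  next
    assume "i div 5 = b \<and> i mod 5 \<in> T"
    then show "i \<in> (+) (5 * b) ` T" using i by (metis imageI)
  qed
  moreover have "i < 5 * b \<longleftrightarrow> i div 5 < b" by linarith
  ultimately show ?thesis by (auto simp: shifted_def)
qed

lemma block_subset: "T \<in> block \<Longrightarrow> T \<subseteq> {..<5}"
  by (auto simp: block_def)

text \<open>\<open>T\<close> is not full and so misses a row of copy \<open>b\<close>, which the
  later set contains. \<open>T'\<close> is an arbitrary subset so that the top set
  \<open>shifted k {}\<close> is covered.\<close>

lemma shifted_less_neq:
  assumes "T \<in> block" "T' \<subseteq> {..<5}" "b < b'"
  shows "shifted b T \<noteq> shifted b' T'"
proof -
  obtain r where r: "r < 5" "r \<notin> T" using assms(1) by (auto simp: block_def)
  then have "5 * b + r \<notin> shifted b T" "5 * b + r \<in> shifted b' T'"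
    using assms by (simp_all add: mem_shifted block_subset)
  then show ?thesis by blast
qed

definition stack :: "nat \<Rightarrow> nat set set" where
  "stack k = insert (shifted k {}) ((\<lambda>(b, T). shifted b T) ` ({..<k} \<times> block))"

lemma finite_block: "finite block"
  by (simp add: block_def)

lemma stackE:
  assumes "A \<in> stack k"
  obtains b T where "A = shifted b T" "T \<subseteq> {..<5}" "b < k \<and> T \<in> block \<or> b = k \<and> T = {}"
  using assms block_subset by (auto simp: stack_def)

lemma card_stack: "card (stack k) = 24 * k + 1"
proof -
  have "inj_on (\<lambda>(b, T). shifted b T) ({..<k} \<times> block)"
  proof (rule inj_onI, clarify)
    fix b T b' T'
    assume *: "T \<in> block" "T' \<in> block" "shifted b T = shifted b' T'"
    have "\<not> b < b'" "\<not> b' < b"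
      using *(3) shifted_less_neq[OF *(1) block_subset[OF *(2)], of b b']
        shifted_less_neq[OF *(2) block_subset[OF *(1)], of b' b] by auto
    then have b: "b = b'" by linarith
    have "T = T'"
    proof (rule Set.set_eqI)
      fix t show "t \<in> T \<longleftrightarrow> t \<in> T'"
      proof (cases "t < 5")
        case True
        then show ?thesis
          using *(3) b mem_shifted[OF block_subset[OF *(1)], of "5 * b + t" b]
            mem_shifted[OF block_subset[OF *(2)], of "5 * b + t" b] by simp
      next
        case False
        then show ?thesis using *(1,2) block_subset by blast
      qed
    qed
    then show "b = b' \<and> T = T'" using b by simp
  qed
  then have "card ((\<lambda>(b, T). shifted b T) ` ({..<k} \<times> block)) = 24 * k"
    by (simp add: card_image card_cartesian_product card_block)
  moreover have "shifted k {} \<notin> (\<lambda>(b, T). shifted b T) ` ({..<k} \<times> block)"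
    using shifted_less_neq[of _ "{}" _ k] by force
  ultimately show ?thesis by (simp add: stack_def finite_block)
qed

text \<open>A set meeting a copy contains all rows of the earlier copies.\<close>

lemma only_stack_later:
  assumes "i div 5 < j div 5"
  shows "only (stack k) j i = {}"
  using assms by (auto simp: only_def mem_shifted elim!: stackE)

text \<open>Sets of another copy contain all rows of the given copy or none, so only the sets of
  that copy separate its rows.\<close>

lemma card_only_stack_same:
  assumes "i div 5 = j div 5"
  shows "card (only (stack k) i j) \<le> 6"
proof (cases "i = j")
  case True
  then have "only (stack k) i j = {}" by (auto simp: only_def)
  then show ?thesis by simp
next
  case False
  then have neq: "i mod 5 \<noteq> j mod 5" using assms by (metis div_mult_mod_eq)
  have "only (stack k) i j \<subseteq> shifted (i div 5) ` only block (i mod 5) (j mod 5)"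
  proof
    fix A assume A: "A \<in> only (stack k) i j"
    then obtain b T where T: "A = shifted b T" "T \<subseteq> {..<5}" "b < k \<and> T \<in> block \<or> b = k \<and> T = {}"
      by (auto simp: only_def elim: stackE)
    then have "b = i div 5" "i mod 5 \<in> T" "j mod 5 \<notin> T"
      using A assms by (auto simp: only_def mem_shifted)
    then show "A \<in> shifted (i div 5) ` only block (i mod 5) (j mod 5)" using T by (auto simp: only_def)
  qed
  then have "card (only (stack k) i j) \<le> card (shifted (i div 5) ` only block (i mod 5) (j mod 5))"
    by (rule card_mono[rotated]) (simp add: only_def finite_block)
  also have "\<dots> \<le> card (only block (i mod 5) (j mod 5))"
    by (rule card_image_le) (simp add: only_def finite_block)
  also have "\<dots> \<le> 6" using neq by (intro card_only_block) auto
  finally show ?thesis .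
qed

lemma forb_F_0p10_7_ge: "24 * k + 1 \<le> forb (5 * k) (F_0p10 7)"
proof -
  have "finite (stack k)" by (simp add: stack_def finite_block)
  moreover have "stack k \<subseteq> Pow {..<5 * k}"
  proof
    fix A assume "A \<in> stack k"
    then obtain b T where T: "A = shifted b T" "T \<subseteq> {..<5}" "b < k \<and> T \<in> block \<or> b = k \<and> T = {}"
      by (rule stackE)
    have "i < 5 * k" if "i \<in> A" for i
    proof -
      have "i div 5 < k" using that T by (auto simp: mem_shifted)
      then show ?thesis by linarith
    qed
    then show "A \<in> Pow {..<5 * k}" by blast
  qed
  moreover have "card (only (stack k) i j) < 7 \<or> only (stack k) j i = {}" for i j
  proof -
    consider "i div 5 < j div 5" | "j div 5 < i div 5" | "i div 5 = j div 5" by linarith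
    then show ?thesis
      using only_stack_later[of i j k] only_stack_later[of j i k] card_only_stack_same[of i j k]
      by cases auto
  qed
  ultimately obtain A where "A \<in> Avoid (5 * k) (F_0p10 7)" "dim_col A = card (stack k)"
    using family_Avoid[of "stack k" "5 * k" 7] by blast
  moreover have "0 < dim_col (F_0p10 7)" by (simp add: F_0p10_def)
  ultimately show ?thesis using forb_attained(2) card_stack by metis
qed

theorem theorem2:
  fixes m :: nat
  assumes "m > 0"
  shows "int (forb m (F_0p10 7)) \<le> \<lfloor>24 / 5 * real m\<rfloor> + 1 \<and>
    ([m = 0] (mod 5) \<longrightarrow> int (forb m (F_0p10 7)) = \<lfloor>24 / 5 * real m\<rfloor> + 1)"
proof -
  have "real (5 * forb m (F_0p10 7)) \<le> real (24 * m + 5)"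
    using forb_F_0p10_7_le by (intro of_nat_mono)
  \<comment> \<open>After division by \<open>5\<close> the left-hand side is an integer, so the
    floor may be taken on the right.\<close>
  then have le: "int (forb m (F_0p10 7)) \<le> \<lfloor>24 / 5 * real m\<rfloor> + 1"
    by linarith
  moreover have "int (forb m (F_0p10 7)) = \<lfloor>24 / 5 * real m\<rfloor> + 1" if m5: "[m = 0] (mod 5)"
  proof -
    obtain k where k: "m = 5 * k" using m5 by (auto simp: cong_0_iff)
    then have "24 / 5 * real m = real_of_int (int (24 * k))" by simp
    then have "\<lfloor>24 / 5 * real m\<rfloor> = int (24 * k)" by (metis floor_of_int)
    then show ?thesis using le forb_F_0p10_7_ge[of k] k by simp
  qed
  ultimately show ?thesis by blast
qed

end
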